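(* Let $\mathcal{C}$ and $\mathcal{D}$ be categories with binary coproducts, $F\colon\mathcal{C}\to\mathcal{D}$ left adjoint to $G\colon\mathcal{D}\to\mathcal{C}$, $H$ an endofunctor on $\mathcal{C}$, $L$ an endofunctor on $\mathcal{D}$, and $\rho\colon HG\Rightarrow GL$ a natural transformation. If $\zeta\colon\Theta\xrightarrow{\cong}L(\Theta)$ is a final $L$-coalgebra, then the $H$-algebra $G(\zeta^{-1})\circ\rho_\Theta\colon HG(\Theta)\to G(\Theta)$ is completely iterative.
   Context: For an endofunctor $K$ on a category with binary coproducts, a $K$-algebra $a\colon K(Y)\to Y$ is completely iterative if for every map $c\colon X\to Y+K(X)$ there is a unique $f\colon X\to Y$ with $f=[\mathrm{id}_Y,a]\circ(Y+K(f))\circ c$. *)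

theory Defs
  imports Main
begin

section \<open>Categories\<close>

record ('o, 'm) category =
  Obj :: "'o set"
  Arr :: "'m set"
  Dom :: "'m \<Rightarrow> 'o"
  Cod :: "'m \<Rightarrow> 'o"
  Ident :: "'o \<Rightarrow> 'm"
  Comp :: "'m \<Rightarrow> 'm \<Rightarrow> 'm"  (infixl "\<cdot>\<index>" 70)

definition hom :: "('o, 'm) category \<Rightarrow> 'o \<Rightarrow> 'o \<Rightarrow> 'm set" where
  "hom C X Y = {f \<in> Arr C. Dom C f = X \<and> Cod C f = Y}"

text \<open>Composition \<^term>\<open>Comp C g f\<close> is written in the order ``\<open>g\<close> after \<open>f\<close>''; its value is
  unspecified on non-composable pairs.\<close>

locale category =
  fixes C :: "('o, 'm) category"  (structure)
  assumes Dom_Obj: "f \<in> Arr C \<Longrightarrow> Dom C f \<in> Obj C"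
    and Cod_Obj: "f \<in> Arr C \<Longrightarrow> Cod C f \<in> Obj C"
    and Ident_hom: "X \<in> Obj C \<Longrightarrow> Ident C X \<in> hom C X X"
    and Comp_hom: "f \<in> hom C X Y \<Longrightarrow> g \<in> hom C Y Z \<Longrightarrow> g \<cdot> f \<in> hom C X Z"
    and Ident_right: "f \<in> hom C X Y \<Longrightarrow> f \<cdot> Ident C X = f"
    and Ident_left: "f \<in> hom C X Y \<Longrightarrow> Ident C Y \<cdot> f = f"
    and Comp_assoc: "f \<in> hom C W X \<Longrightarrow> g \<in> hom C X Y \<Longrightarrow> h \<in> hom C Y Z
      \<Longrightarrow> (h \<cdot> g) \<cdot> f = h \<cdot> (g \<cdot> f)"

definition is_inverse :: "('o, 'm) category \<Rightarrow> 'm \<Rightarrow> 'm \<Rightarrow> bool" where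
  "is_inverse C f g \<longleftrightarrow> f \<in> Arr C \<and> g \<in> hom C (Cod C f) (Dom C f)
     \<and> g \<cdot>\<^bsub>C\<^esub> f = Ident C (Dom C f) \<and> f \<cdot>\<^bsub>C\<^esub> g = Ident C (Cod C f)"

definition inverse_arr :: "('o, 'm) category \<Rightarrow> 'm \<Rightarrow> 'm" where
  "inverse_arr C f = (THE g. is_inverse C f g)"


section \<open>Functors, natural transformations, adjunctions\<close>

record ('o1, 'm1, 'o2, 'm2) funct =
  Fobj :: "'o1 \<Rightarrow> 'o2"
  Farr :: "'m1 \<Rightarrow> 'm2"

locale is_functor = src: category C + tgt: category D
  for C :: "('o1, 'm1) category" and D :: "('o2, 'm2) category" +
  fixes F :: "('o1, 'm1, 'o2, 'm2) funct"
  assumes Fobj_Obj: "X \<in> Obj C \<Longrightarrow> Fobj F X \<in> Obj D"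
    and Farr_hom: "f \<in> hom C X Y \<Longrightarrow> Farr F f \<in> hom D (Fobj F X) (Fobj F Y)"
    and Farr_Ident: "X \<in> Obj C \<Longrightarrow> Farr F (Ident C X) = Ident D (Fobj F X)"
    and Farr_Comp: "f \<in> hom C X Y \<Longrightarrow> g \<in> hom C Y Z
      \<Longrightarrow> Farr F (g \<cdot>\<^bsub>C\<^esub> f) = Farr F g \<cdot>\<^bsub>D\<^esub> Farr F f"

definition funct_comp :: "('o2, 'm2, 'o3, 'm3) funct \<Rightarrow> ('o1, 'm1, 'o2, 'm2) funct
    \<Rightarrow> ('o1, 'm1, 'o3, 'm3) funct"  (infixl "\<circ>\<^sub>F" 70) where
  "F \<circ>\<^sub>F G = \<lparr>Fobj = Fobj F \<circ> Fobj G, Farr = Farr F \<circ> Farr G\<rparr>"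

locale nat_trans = source: is_functor C D F + target: is_functor C D G
  for C :: "('o1, 'm1) category" and D :: "('o2, 'm2) category"
    and F G :: "('o1, 'm1, 'o2, 'm2) funct" +
  fixes \<tau> :: "'o1 \<Rightarrow> 'm2"
  assumes component_hom: "X \<in> Obj C \<Longrightarrow> \<tau> X \<in> hom D (Fobj F X) (Fobj G X)"
    and naturality: "f \<in> hom C X Y \<Longrightarrow> \<tau> Y \<cdot>\<^bsub>D\<^esub> Farr F f = Farr G f \<cdot>\<^bsub>D\<^esub> \<tau> X"

text \<open>An adjunction is a family of bijections between the hom-sets \<^term>\<open>hom D (Fobj F X) A\<close> and
  \<^term>\<open>hom C X (Fobj G A)\<close>, natural in \<open>X\<close> and \<open>A\<close>.\<close>

locale adjunction = left: is_functor C D F + right: is_functor D C G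
  for C :: "('o1, 'm1) category" and D :: "('o2, 'm2) category"
    and F :: "('o1, 'm1, 'o2, 'm2) funct" and G :: "('o2, 'm2, 'o1, 'm1) funct" +
  fixes \<phi> :: "'o1 \<Rightarrow> 'o2 \<Rightarrow> 'm2 \<Rightarrow> 'm1"
  assumes transpose_bij: "X \<in> Obj C \<Longrightarrow> A \<in> Obj D
      \<Longrightarrow> bij_betw (\<phi> X A) (hom D (Fobj F X) A) (hom C X (Fobj G A))"
    and transpose_natural: "f \<in> hom C X' X \<Longrightarrow> h \<in> hom D (Fobj F X) A \<Longrightarrow> k \<in> hom D A B
      \<Longrightarrow> \<phi> X' B (k \<cdot>\<^bsub>D\<^esub> h \<cdot>\<^bsub>D\<^esub> Farr F f) = Farr G k \<cdot>\<^bsub>C\<^esub> \<phi> X A h \<cdot>\<^bsub>C\<^esub> f"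

definition left_adjoint :: "('o1, 'm1) category \<Rightarrow> ('o2, 'm2) category
    \<Rightarrow> ('o1, 'm1, 'o2, 'm2) funct \<Rightarrow> ('o2, 'm2, 'o1, 'm1) funct \<Rightarrow> bool" where
  "left_adjoint C D F G \<longleftrightarrow> (\<exists>\<phi>. adjunction C D F G \<phi>)"


section \<open>Binary coproducts\<close>

text \<open>A category with binary coproducts comes with a choice of coproduct object and injections
  for each pair of objects, so that \<open>Y + K X\<close> denotes a specific object.\<close>

record ('o, 'm) coproducts =
  Coprod :: "'o \<Rightarrow> 'o \<Rightarrow> 'o"
  In1 :: "'o \<Rightarrow> 'o \<Rightarrow> 'm"
  In2 :: "'o \<Rightarrow> 'o \<Rightarrow> 'm"

locale binary_coproducts = category C
  for C :: "('o, 'm) category" +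
  fixes S :: "('o, 'm) coproducts"
  assumes Coprod_Obj: "A \<in> Obj C \<Longrightarrow> B \<in> Obj C \<Longrightarrow> Coprod S A B \<in> Obj C"
    and In1_hom: "A \<in> Obj C \<Longrightarrow> B \<in> Obj C \<Longrightarrow> In1 S A B \<in> hom C A (Coprod S A B)"
    and In2_hom: "A \<in> Obj C \<Longrightarrow> B \<in> Obj C \<Longrightarrow> In2 S A B \<in> hom C B (Coprod S A B)"
    and copair_universal: "A \<in> Obj C \<Longrightarrow> B \<in> Obj C \<Longrightarrow> f \<in> hom C A Z \<Longrightarrow> g \<in> hom C B Z
      \<Longrightarrow> \<exists>!h. h \<in> hom C (Coprod S A B) Z \<and> h \<cdot>\<^bsub>C\<^esub> In1 S A B = f \<and> h \<cdot>\<^bsub>C\<^esub> In2 S A B = g"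

definition copair :: "('o, 'm) category \<Rightarrow> ('o, 'm) coproducts \<Rightarrow> 'm \<Rightarrow> 'm \<Rightarrow> 'm" where
  "copair C S f g = (THE h. h \<in> hom C (Coprod S (Dom C f) (Dom C g)) (Cod C f)
     \<and> h \<cdot>\<^bsub>C\<^esub> In1 S (Dom C f) (Dom C g) = f \<and> h \<cdot>\<^bsub>C\<^esub> In2 S (Dom C f) (Dom C g) = g)"

definition coprod_arr :: "('o, 'm) category \<Rightarrow> ('o, 'm) coproducts \<Rightarrow> 'm \<Rightarrow> 'm \<Rightarrow> 'm" where
  "coprod_arr C S f g = copair C S
     (In1 S (Cod C f) (Cod C g) \<cdot>\<^bsub>C\<^esub> f) (In2 S (Cod C f) (Cod C g) \<cdot>\<^bsub>C\<^esub> g)"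


section \<open>Algebras and coalgebras\<close>

definition is_algebra :: "('o, 'm) category \<Rightarrow> ('o, 'm, 'o, 'm) funct \<Rightarrow> 'o \<Rightarrow> 'm \<Rightarrow> bool" where
  "is_algebra C K Y a \<longleftrightarrow> Y \<in> Obj C \<and> a \<in> hom C (Fobj K Y) Y"

definition is_coalgebra :: "('o, 'm) category \<Rightarrow> ('o, 'm, 'o, 'm) funct \<Rightarrow> 'o \<Rightarrow> 'm \<Rightarrow> bool" where
  "is_coalgebra C K X c \<longleftrightarrow> X \<in> Obj C \<and> c \<in> hom C X (Fobj K X)"

definition coalgebra_hom :: "('o, 'm) category \<Rightarrow> ('o, 'm, 'o, 'm) funct
    \<Rightarrow> 'o \<Rightarrow> 'm \<Rightarrow> 'o \<Rightarrow> 'm \<Rightarrow> 'm \<Rightarrow> bool" where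
  "coalgebra_hom C K X c Y d f \<longleftrightarrow> f \<in> hom C X Y \<and> d \<cdot>\<^bsub>C\<^esub> f = Farr K f \<cdot>\<^bsub>C\<^esub> c"

definition final_coalgebra :: "('o, 'm) category \<Rightarrow> ('o, 'm, 'o, 'm) funct \<Rightarrow> 'o \<Rightarrow> 'm \<Rightarrow> bool" where
  "final_coalgebra C K \<Theta> \<zeta> \<longleftrightarrow> is_coalgebra C K \<Theta> \<zeta>
     \<and> (\<forall>X c. is_coalgebra C K X c \<longrightarrow> (\<exists>!f. coalgebra_hom C K X c \<Theta> \<zeta> f))"

definition completely_iterative :: "('o, 'm) category \<Rightarrow> ('o, 'm) coproducts
    \<Rightarrow> ('o, 'm, 'o, 'm) funct \<Rightarrow> 'o \<Rightarrow> 'm \<Rightarrow> bool" where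
  "completely_iterative C S K Y a \<longleftrightarrow> is_algebra C K Y a
     \<and> (\<forall>X \<in> Obj C. \<forall>c \<in> hom C X (Coprod S Y (Fobj K X)).
          \<exists>!f. f \<in> hom C X Y
             \<and> f = copair C S (Ident C Y) a \<cdot>\<^bsub>C\<^esub> coprod_arr C S (Ident C Y) (Farr K f) \<cdot>\<^bsub>C\<^esub> c)"

lemma (in category) inverse_arr_eq:
  assumes "is_inverse C f g"
  shows "inverse_arr C f = g"
  unfolding inverse_arr_def
proof (rule the_equality)
  fix h assume h: "is_inverse C f h"
  have f: "f \<in> hom C (Dom C f) (Cod C f)"
    using assms by (simp add: is_inverse_def hom_def)
  have gh: "g \<in> hom C (Cod C f) (Dom C f)" "h \<in> hom C (Cod C f) (Dom C f)"
    using assms h by (simp_all add: is_inverse_def)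
  have "h = h \<cdot> (f \<cdot> g)"
    using assms gh(2) by (simp add: is_inverse_def Ident_right)
  also have "\<dots> = (h \<cdot> f) \<cdot> g"
    by (rule Comp_assoc[OF gh(1) f gh(2), symmetric])
  also have "\<dots> = g"
    using h gh(1) by (simp add: is_inverse_def Ident_left)
  finally show "h = g" .
qed (fact assms)

text \<open>Lambek's lemma: \<^term>\<open>inverse_arr\<close> is meaningful on the structure map of a final coalgebra.\<close>

lemma final_coalgebra_inverse:
  assumes "is_functor C C K" and fin: "final_coalgebra C K \<Theta> \<zeta>"
  shows "is_inverse C \<zeta> (inverse_arr C \<zeta>)"
proof -
  interpret K: is_functor C C K by fact
  have T: "\<Theta> \<in> Obj C" and z: "\<zeta> \<in> hom C \<Theta> (Fobj K \<Theta>)"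
    using fin by (simp_all add: final_coalgebra_def is_coalgebra_def)
  have dc: "Dom C \<zeta> = \<Theta>" "Cod C \<zeta> = Fobj K \<Theta>" "\<zeta> \<in> Arr C"
    using z by (simp_all add: hom_def)
  have Kz: "Farr K \<zeta> \<in> hom C (Fobj K \<Theta>) (Fobj K (Fobj K \<Theta>))"
    by (rule K.Farr_hom[OF z])
  have "is_coalgebra C K (Fobj K \<Theta>) (Farr K \<zeta>)"
    using Kz K.Fobj_Obj[OF T] by (simp add: is_coalgebra_def)
  then obtain g where "coalgebra_hom C K (Fobj K \<Theta>) (Farr K \<zeta>) \<Theta> \<zeta> g"
    using fin unfolding final_coalgebra_def by blast
  then have g: "g \<in> hom C (Fobj K \<Theta>) \<Theta>"
    and gc: "\<zeta> \<cdot>\<^bsub>C\<^esub> g = Farr K g \<cdot>\<^bsub>C\<^esub> Farr K \<zeta>"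
    by (simp_all add: coalgebra_hom_def)
  have Kgz: "Farr K (g \<cdot>\<^bsub>C\<^esub> \<zeta>) = Farr K g \<cdot>\<^bsub>C\<^esub> Farr K \<zeta>"
    by (rule K.Farr_Comp[OF z g])
  have "coalgebra_hom C K \<Theta> \<zeta> \<Theta> \<zeta> (g \<cdot>\<^bsub>C\<^esub> \<zeta>)"
    using K.src.Comp_hom[OF z g] K.src.Comp_assoc[OF z g z] gc Kgz
    by (simp add: coalgebra_hom_def)
  moreover have "coalgebra_hom C K \<Theta> \<zeta> \<Theta> \<zeta> (Ident C \<Theta>)"
    using K.src.Ident_hom[OF T] z T
    by (simp add: coalgebra_hom_def K.Farr_Ident K.src.Ident_left K.src.Ident_right)
  moreover have "\<exists>!f. coalgebra_hom C K \<Theta> \<zeta> \<Theta> \<zeta> f"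
    using fin unfolding final_coalgebra_def by blast
  ultimately have gz: "g \<cdot>\<^bsub>C\<^esub> \<zeta> = Ident C \<Theta>"
    by blast
  have "is_inverse C \<zeta> g"
    using g gz gc Kgz dc T by (simp add: is_inverse_def K.Farr_Ident)
  then show ?thesis
    by (simp add: K.src.inverse_arr_eq)
qed

end

theory Submission
  imports Defs
begin

text \<open>Let \<open>a = G(\<zeta>\<^sup>-\<^sup>1) \<circ> \<rho>\<^sub>\<Theta>\<close> and \<open>c: X \<rightarrow> G\<Theta> + HX\<close>. On \<open>A = \<Theta> + FX\<close> consider the \<open>L\<close>-coalgebra
  \<open>d = [L inl \<circ> \<zeta>, e]\<close>, where \<open>e: FX \<rightarrow> LA\<close> is the transpose of
  \<open>[GL inl \<circ> G\<zeta>, \<rho>\<^sub>A \<circ> H(inr\<^sup>\<flat>)] \<circ> c: X \<rightarrow> GLA\<close> and \<open>inr\<^sup>\<flat>: X \<rightarrow> GA\<close> is the transpose of the injection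
  \<open>inr: FX \<rightarrow> A\<close>. A homomorphism from \<open>(A, d)\<close> to \<open>(\<Theta>, \<zeta>)\<close> restricts along \<open>inl\<close> to an
  endomorphism of the final coalgebra, so it has the form \<open>[id, g]\<close>; transposing the condition on
  \<open>g\<close> and using naturality of \<open>\<rho>\<close> gives \<open>G\<zeta> \<circ> f = [G\<zeta>, \<rho>\<^sub>\<Theta> \<circ> Hf] \<circ> c\<close> for the transpose \<open>f\<close> of
  \<open>g\<close>, that is, \<open>f = [id, a \<circ> Hf] \<circ> c\<close>. Hence solutions of \<open>c\<close> correspond to homomorphisms
  \<open>(A, d) \<rightarrow> (\<Theta>, \<zeta>)\<close>, and there is exactly one.\<close>

section \<open>Composite functors and cancellation of split monomorphisms\<close>

lemma funct_comp_simps [simp]: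
  "Fobj (F \<circ>\<^sub>F G) X = Fobj F (Fobj G X)"
  "Farr (F \<circ>\<^sub>F G) f = Farr F (Farr G f)"
  by (simp_all add: funct_comp_def)

lemma (in category) hom_Obj:
  assumes "f \<in> hom C X Y"
  shows "X \<in> Obj C" "Y \<in> Obj C"
  using assms Dom_Obj Cod_Obj by (auto simp: hom_def)

text \<open>Composing with the retraction \<open>r\<close> recovers \<open>f\<close> and
  \<open>g\<close>. With \<open>s\<close> the image of \<zeta> under \<open>G\<close>, this serves
  to clear the inverse of \<zeta> from the solution equation.\<close>

lemma (in category) split_mono_cancel:
  assumes "s \<in> hom C Y Z" "r \<in> hom C Z Y" "r \<cdot> s = Ident C Y"
    and "f \<in> hom C X Y" "g \<in> hom C X Y"
  shows "s \<cdot> f = s \<cdot> g \<longleftrightarrow> f = g"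
  using Comp_assoc[OF assms(4,1,2)] Comp_assoc[OF assms(5,1,2)] Ident_left[OF assms(4)]
    Ident_left[OF assms(5)] assms(3) by metis

section \<open>Calculus of copairings\<close>

context binary_coproducts
begin

lemma copair:
  assumes f: "f \<in> hom C A Z" and g: "g \<in> hom C B Z"
  shows copair_hom: "copair C S f g \<in> hom C (Coprod S A B) Z"
    and copair_In1: "copair C S f g \<cdot>\<^bsub>C\<^esub> In1 S A B = f"
    and copair_In2: "copair C S f g \<cdot>\<^bsub>C\<^esub> In2 S A B = g"
proof -
  have dc: "Dom C f = A" "Dom C g = B" "Cod C f = Z"
    using f g by (auto simp: hom_def)
  have "\<exists>!h. h \<in> hom C (Coprod S A B) Z \<and> h \<cdot>\<^bsub>C\<^esub> In1 S A B = f \<and> h \<cdot>\<^bsub>C\<^esub> In2 S A B = g"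
    using copair_universal[OF _ _ f g] hom_Obj[OF f] hom_Obj[OF g] by blast
  from theI'[OF this] show "copair C S f g \<in> hom C (Coprod S A B) Z"
    "copair C S f g \<cdot>\<^bsub>C\<^esub> In1 S A B = f" "copair C S f g \<cdot>\<^bsub>C\<^esub> In2 S A B = g"
    by (simp_all add: copair_def dc)
qed

text \<open>Both arrows mediate the cocone obtained by restricting \<open>h\<close> to the two
  summands, so uniqueness in the universal property identifies them.\<close>

lemma coprod_eqI:
  assumes "A \<in> Obj C" "B \<in> Obj C"
    and h: "h \<in> hom C (Coprod S A B) Z" and k: "k \<in> hom C (Coprod S A B) Z"
    and "h \<cdot>\<^bsub>C\<^esub> In1 S A B = k \<cdot>\<^bsub>C\<^esub> In1 S A B" "h \<cdot>\<^bsub>C\<^esub> In2 S A B = k \<cdot>\<^bsub>C\<^esub> In2 S A B"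
  shows "h = k"
proof -
  let ?P = "\<lambda>m. m \<in> hom C (Coprod S A B) Z
    \<and> m \<cdot>\<^bsub>C\<^esub> In1 S A B = h \<cdot>\<^bsub>C\<^esub> In1 S A B \<and> m \<cdot>\<^bsub>C\<^esub> In2 S A B = h \<cdot>\<^bsub>C\<^esub> In2 S A B"
  have uniq: "\<exists>!m. ?P m"
    by (rule copair_universal[OF assms(1,2) Comp_hom[OF In1_hom[OF assms(1,2)] h]
          Comp_hom[OF In2_hom[OF assms(1,2)] h]])
  have Ph: "?P h" and Pk: "?P k"
    using h k assms(5,6) by simp_all
  from the1_equality[OF uniq Ph, symmetric] the1_equality[OF uniq Pk] show ?thesis
    by (rule trans)
qed

lemma Comp_copair:
  assumes f: "f \<in> hom C A Z" and g: "g \<in> hom C B Z" and k: "k \<in> hom C Z W"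
  shows "k \<cdot>\<^bsub>C\<^esub> copair C S f g = copair C S (k \<cdot>\<^bsub>C\<^esub> f) (k \<cdot>\<^bsub>C\<^esub> g)"
proof -
  have A: "A \<in> Obj C" and B: "B \<in> Obj C"
    using hom_Obj f g by blast+
  note fg = copair_hom[OF f g]
  note kfkg = Comp_hom[OF f k] Comp_hom[OF g k]
  show ?thesis
    by (rule coprod_eqI[OF A B Comp_hom[OF fg k] copair_hom[OF kfkg]])
      (simp_all add: Comp_assoc[OF In1_hom[OF A B] fg k] Comp_assoc[OF In2_hom[OF A B] fg k]
        copair_In1[OF f g] copair_In2[OF f g] copair_In1[OF kfkg] copair_In2[OF kfkg])
qed

text \<open>Since \<open>coprod_arr\<close> is itself a copairing, \<open>Comp_copair\<close>
  reduces the claim to the values of \<open>copair C S f g\<close> on the injections.\<close>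

lemma copair_coprod_arr:
  assumes f: "f \<in> hom C A Z" and g: "g \<in> hom C B Z"
    and u: "u \<in> hom C A' A" and v: "v \<in> hom C B' B"
  shows "copair C S f g \<cdot>\<^bsub>C\<^esub> coprod_arr C S u v = copair C S (f \<cdot>\<^bsub>C\<^esub> u) (g \<cdot>\<^bsub>C\<^esub> v)"
proof -
  have A: "A \<in> Obj C" and B: "B \<in> Obj C"
    using hom_Obj f g by blast+
  have eq: "coprod_arr C S u v = copair C S (In1 S A B \<cdot>\<^bsub>C\<^esub> u) (In2 S A B \<cdot>\<^bsub>C\<^esub> v)"
    using u v by (auto simp: coprod_arr_def hom_def)
  note i = In1_hom[OF A B] and j = In2_hom[OF A B]
  note fg = copair_hom[OF f g]
  show "copair C S f g \<cdot>\<^bsub>C\<^esub> coprod_arr C S u v = copair C S (f \<cdot>\<^bsub>C\<^esub> u) (g \<cdot>\<^bsub>C\<^esub> v)"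
    unfolding eq Comp_copair[OF Comp_hom[OF u i] Comp_hom[OF v j] fg]
    by (simp add: Comp_assoc[OF u i fg, symmetric] Comp_assoc[OF v j fg, symmetric]
        copair_In1[OF f g] copair_In2[OF f g])
qed

end

section \<open>Calculus of transposition\<close>

context adjunction
begin

lemma transpose_hom:
  assumes "X \<in> Obj C" and h: "h \<in> hom D (Fobj F X) A"
  shows "\<phi> X A h \<in> hom C X (Fobj G A)"
  using transpose_bij[OF assms(1) left.tgt.hom_Obj(2)[OF h]] h by (auto dest: bij_betwE)

lemma transpose_eq_iff:
  assumes "X \<in> Obj C" and h: "h \<in> hom D (Fobj F X) A" and k: "k \<in> hom D (Fobj F X) A"
  shows "\<phi> X A h = \<phi> X A k \<longleftrightarrow> h = k"
  using transpose_bij[OF assms(1) left.tgt.hom_Obj(2)[OF h]] h k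
  by (auto simp: bij_betw_def dest: inj_onD)

lemma transpose_surj:
  assumes "X \<in> Obj C" "A \<in> Obj D" "f \<in> hom C X (Fobj G A)"
  obtains h where "h \<in> hom D (Fobj F X) A" "\<phi> X A h = f"
proof -
  have "f \<in> \<phi> X A ` hom D (Fobj F X) A"
    using bij_betw_imp_surj_on[OF transpose_bij[OF assms(1,2)]] assms(3) by simp
  with that show thesis by (elim imageE) simp
qed

text \<open>Taking the arrow of \<open>C\<close> in \<open>transpose_natural\<close> to be the
  identity of \<open>X\<close> leaves naturality in the second variable alone.\<close>

lemma transpose_Comp:
  assumes X: "X \<in> Obj C" and h: "h \<in> hom D (Fobj F X) A" and k: "k \<in> hom D A B"
  shows "\<phi> X B (k \<cdot>\<^bsub>D\<^esub> h) = Farr G k \<cdot>\<^bsub>C\<^esub> \<phi> X A h"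
  using transpose_natural[OF left.src.Ident_hom[OF X] h k]
  by (simp add: left.Farr_Ident[OF X] left.tgt.Ident_right[OF left.tgt.Comp_hom[OF h k]]
      left.src.Ident_right[OF left.src.Comp_hom[OF transpose_hom[OF X h] right.Farr_hom[OF k]]])

end

theorem theorem8p3:
  fixes C :: "('o1, 'm1) category" and D :: "('o2, 'm2) category"
    and SC :: "('o1, 'm1) coproducts" and SD :: "('o2, 'm2) coproducts"
    and F :: "('o1, 'm1, 'o2, 'm2) funct" and G :: "('o2, 'm2, 'o1, 'm1) funct"
    and H :: "('o1, 'm1, 'o1, 'm1) funct" and L :: "('o2, 'm2, 'o2, 'm2) funct"
    and \<rho> :: "'o2 \<Rightarrow> 'm1" and \<Theta> :: 'o2 and \<zeta> :: 'm2
  assumes "binary_coproducts C SC" and "binary_coproducts D SD"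
    and "left_adjoint C D F G"
    and "is_functor C C H" and "is_functor D D L"
    and "nat_trans D C (H \<circ>\<^sub>F G) (G \<circ>\<^sub>F L) \<rho>"
    and "final_coalgebra D L \<Theta> \<zeta>"
  shows "completely_iterative C SC H (Fobj G \<Theta>) (Farr G (inverse_arr D \<zeta>) \<cdot>\<^bsub>C\<^esub> \<rho> \<Theta>)"
proof -
  from assms(3) obtain \<phi> where adj: "adjunction C D F G \<phi>"
    by (auto simp: left_adjoint_def)
  interpret C: binary_coproducts C SC by fact
  interpret D: binary_coproducts D SD by fact
  interpret adj: adjunction C D F G \<phi> by (fact adj)
  interpret H: is_functor C C H by fact
  interpret L: is_functor D D L by fact
  interpret \<rho>: nat_trans D C "H \<circ>\<^sub>F G" "G \<circ>\<^sub>F L" \<rho> by fact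
  note \<rho>_hom = \<rho>.component_hom[simplified] and \<rho>_nat = \<rho>.naturality[simplified]
  define z where "z = inverse_arr D \<zeta>"
  define Y where "Y = Fobj G \<Theta>"
  define a where "a = Farr G z \<cdot>\<^bsub>C\<^esub> \<rho> \<Theta>"
  have T: "\<Theta> \<in> Obj D" and \<zeta>: "\<zeta> \<in> hom D \<Theta> (Fobj L \<Theta>)"
    using assms(7) by (simp_all add: final_coalgebra_def is_coalgebra_def)
  have final: "\<exists>!h. coalgebra_hom D L A d \<Theta> \<zeta> h" if "A \<in> Obj D" "d \<in> hom D A (Fobj L A)" for A d
    using assms(7) that by (simp add: final_coalgebra_def is_coalgebra_def)
  have LT: "Fobj L \<Theta> \<in> Obj D" by (rule L.Fobj_Obj[OF T])
  have z: "z \<in> hom D (Fobj L \<Theta>) \<Theta>" and z\<zeta>: "z \<cdot>\<^bsub>D\<^esub> \<zeta> = Ident D \<Theta>"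
    and \<zeta>z: "\<zeta> \<cdot>\<^bsub>D\<^esub> z = Ident D (Fobj L \<Theta>)"
    using final_coalgebra_inverse[OF assms(5,7)] \<zeta> by (auto simp: z_def is_inverse_def hom_def)
  have Y: "Y \<in> Obj C" unfolding Y_def by (rule adj.right.Fobj_Obj[OF T])
  have idT: "Ident D \<Theta> \<in> hom D \<Theta> \<Theta>" by (rule D.Ident_hom[OF T])
  have idY: "Ident C Y \<in> hom C Y Y" by (rule C.Ident_hom[OF Y])
  have \<rho>T: "\<rho> \<Theta> \<in> hom C (Fobj H Y) (Fobj G (Fobj L \<Theta>))"
    unfolding Y_def by (rule \<rho>_hom[OF T])
  have Gz: "Farr G z \<in> hom C (Fobj G (Fobj L \<Theta>)) Y"
    and G\<zeta>: "Farr G \<zeta> \<in> hom C Y (Fobj G (Fobj L \<Theta>))"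
    unfolding Y_def by (rule adj.right.Farr_hom[OF z], rule adj.right.Farr_hom[OF \<zeta>])
  have Gz\<zeta>: "Farr G z \<cdot>\<^bsub>C\<^esub> Farr G \<zeta> = Ident C Y"
    using adj.right.Farr_Comp[OF \<zeta> z] by (simp add: z\<zeta> adj.right.Farr_Ident[OF T] Y_def)
  have G\<zeta>z: "Farr G \<zeta> \<cdot>\<^bsub>C\<^esub> Farr G z = Ident C (Fobj G (Fobj L \<Theta>))"
    using adj.right.Farr_Comp[OF z \<zeta>] by (simp add: \<zeta>z adj.right.Farr_Ident[OF LT])
  have a: "a \<in> hom C (Fobj H Y) Y"
    unfolding a_def by (rule C.Comp_hom[OF \<rho>T Gz])
  \<comment> \<open>Here \<open>Farr G \<zeta>\<close> undoes the factor \<open>Farr G z\<close> of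
    \<open>a\<close>, so equations composed with it no longer mention the inverse.\<close>
  have G\<zeta>a: "Farr G \<zeta> \<cdot>\<^bsub>C\<^esub> a = \<rho> \<Theta>"
    unfolding a_def C.Comp_assoc[OF \<rho>T Gz G\<zeta>, symmetric] G\<zeta>z by (rule C.Ident_left[OF \<rho>T])
  have "\<exists>!f. f \<in> hom C X Y
      \<and> f = copair C SC (Ident C Y) a \<cdot>\<^bsub>C\<^esub> coprod_arr C SC (Ident C Y) (Farr H f) \<cdot>\<^bsub>C\<^esub> c"
    if X: "X \<in> Obj C" and c: "c \<in> hom C X (Coprod SC Y (Fobj H X))" for X c
  proof -
    define solves where "solves f \<longleftrightarrow>
      f = copair C SC (Ident C Y) a \<cdot>\<^bsub>C\<^esub> coprod_arr C SC (Ident C Y) (Farr H f) \<cdot>\<^bsub>C\<^esub> c" for f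
    \<comment> \<open>Postcomposing with \<open>Farr G \<zeta>\<close> loses nothing, as
      \<open>Farr G z\<close> is a retraction of it.\<close>
    have solves_iff: "solves f \<longleftrightarrow>
        Farr G \<zeta> \<cdot>\<^bsub>C\<^esub> f = copair C SC (Farr G \<zeta>) (\<rho> \<Theta> \<cdot>\<^bsub>C\<^esub> Farr H f) \<cdot>\<^bsub>C\<^esub> c"
      if f: "f \<in> hom C X Y" for f
    proof -
      note Hf = H.Farr_hom[OF f]
      note aHf = C.Comp_hom[OF Hf a]
      define m where "m = copair C SC (Ident C Y) (a \<cdot>\<^bsub>C\<^esub> Farr H f)"
      have m: "m \<in> hom C (Coprod SC Y (Fobj H X)) Y"
        unfolding m_def by (rule C.copair_hom[OF idY aHf])
      have "solves f \<longleftrightarrow> f = m \<cdot>\<^bsub>C\<^esub> c"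
        unfolding solves_def m_def C.copair_coprod_arr[OF idY a idY Hf] C.Ident_left[OF idY] ..
      also have "\<dots> \<longleftrightarrow> Farr G \<zeta> \<cdot>\<^bsub>C\<^esub> f = Farr G \<zeta> \<cdot>\<^bsub>C\<^esub> (m \<cdot>\<^bsub>C\<^esub> c)"
        by (rule C.split_mono_cancel[OF G\<zeta> Gz Gz\<zeta> f C.Comp_hom[OF c m], symmetric])
      also have "Farr G \<zeta> \<cdot>\<^bsub>C\<^esub> (m \<cdot>\<^bsub>C\<^esub> c) = (Farr G \<zeta> \<cdot>\<^bsub>C\<^esub> m) \<cdot>\<^bsub>C\<^esub> c"
        by (rule C.Comp_assoc[OF c m G\<zeta>, symmetric])
      also have "Farr G \<zeta> \<cdot>\<^bsub>C\<^esub> m = copair C SC (Farr G \<zeta>) (\<rho> \<Theta> \<cdot>\<^bsub>C\<^esub> Farr H f)"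
        by (simp add: m_def C.Comp_copair[OF idY aHf G\<zeta>] C.Ident_right[OF G\<zeta>]
            C.Comp_assoc[OF Hf a G\<zeta>, symmetric] G\<zeta>a)
      finally show ?thesis .
    qed

    \<comment> \<open>The \<open>L\<close>-coalgebra \<open>d\<close> on the coproduct of \<Theta>
      and \<open>F X\<close>\<close>
    define B where "B = Fobj F X"
    have B: "B \<in> Obj D" unfolding B_def by (rule adj.left.Fobj_Obj[OF X])
    define A where "A = Coprod SD \<Theta> B"
    define i where "i = In1 SD \<Theta> B"
    define j where "j = In2 SD \<Theta> B"
    have A: "A \<in> Obj D" and i: "i \<in> hom D \<Theta> A" and j: "j \<in> hom D B A"
      unfolding A_def i_def j_def by (rule D.Coprod_Obj[OF T B] D.In1_hom[OF T B] D.In2_hom[OF T B])+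
    note Li = L.Farr_hom[OF i]
    note Li\<zeta> = D.Comp_hom[OF \<zeta> Li]
    note GLi = adj.right.Farr_hom[OF Li]
    note p = C.Comp_hom[OF G\<zeta> GLi]
    have tj: "\<phi> X A j \<in> hom C X (Fobj G A)"
      using adj.transpose_hom[OF X] j by (simp add: B_def)
    note Htj = H.Farr_hom[OF tj]
    note \<rho>A = \<rho>_hom[OF A]
    note q = C.Comp_hom[OF Htj \<rho>A]
    define s where "s = copair C SC (Farr G (Farr L i) \<cdot>\<^bsub>C\<^esub> Farr G \<zeta>) (\<rho> A \<cdot>\<^bsub>C\<^esub> Farr H (\<phi> X A j))"
    have s: "s \<in> hom C (Coprod SC Y (Fobj H X)) (Fobj G (Fobj L A))"
      unfolding s_def by (rule C.copair_hom[OF p q])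
    \<comment> \<open>Transposition is onto, so the map \<open>s\<close> after \<open>c\<close> into
      \<open>G L A\<close> comes from an arrow of \<open>D\<close>, which becomes the
      \<open>B\<close>-component of \<open>d\<close>.\<close>
    obtain e where e: "e \<in> hom D B (Fobj L A)" and te: "\<phi> X (Fobj L A) e = s \<cdot>\<^bsub>C\<^esub> c"
      using adj.transpose_surj[OF X L.Fobj_Obj[OF A] C.Comp_hom[OF c s]] by (auto simp: B_def)
    define d where "d = copair D SD (Farr L i \<cdot>\<^bsub>D\<^esub> \<zeta>) e"
    have d: "d \<in> hom D A (Fobj L A)" and di: "d \<cdot>\<^bsub>D\<^esub> i = Farr L i \<cdot>\<^bsub>D\<^esub> \<zeta>" and dj: "d \<cdot>\<^bsub>D\<^esub> j = e"
      unfolding A_def i_def j_def d_def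
      by (rule D.copair[OF Li\<zeta> e, unfolded A_def i_def])+

    \<comment> \<open>By \<open>di\<close> the injection \<open>i\<close> is a homomorphism from
      \<zeta> to \<open>d\<close>; its composite with \<open>h\<close> is thus an endomorphism of
      the final coalgebra.\<close>
    have hom_i: "h \<cdot>\<^bsub>D\<^esub> i = Ident D \<Theta>" if h: "coalgebra_hom D L A d \<Theta> \<zeta> h" for h
    proof -
      have hA: "h \<in> hom D A \<Theta>" and hd: "\<zeta> \<cdot>\<^bsub>D\<^esub> h = Farr L h \<cdot>\<^bsub>D\<^esub> d"
        using h by (simp_all add: coalgebra_hom_def)
      note Lh = L.Farr_hom[OF hA]
      have "\<zeta> \<cdot>\<^bsub>D\<^esub> (h \<cdot>\<^bsub>D\<^esub> i) = Farr L h \<cdot>\<^bsub>D\<^esub> (d \<cdot>\<^bsub>D\<^esub> i)"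
        by (metis D.Comp_assoc[OF i hA \<zeta>] D.Comp_assoc[OF i d Lh] hd)
      also have "\<dots> = Farr L (h \<cdot>\<^bsub>D\<^esub> i) \<cdot>\<^bsub>D\<^esub> \<zeta>"
        by (simp add: di L.Farr_Comp[OF i hA] D.Comp_assoc[OF \<zeta> Li Lh])
      finally have "coalgebra_hom D L \<Theta> \<zeta> \<Theta> \<zeta> (h \<cdot>\<^bsub>D\<^esub> i)"
        using D.Comp_hom[OF i hA] by (simp add: coalgebra_hom_def)
      moreover have "coalgebra_hom D L \<Theta> \<zeta> \<Theta> \<zeta> (Ident D \<Theta>)"
        using idT \<zeta> by (simp add: coalgebra_hom_def L.Farr_Ident[OF T] D.Ident_left D.Ident_right)
      ultimately show ?thesis
        using final[OF T \<zeta>] by blast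
    qed

    \<comment> \<open>Once \<open>h\<close> is the identity on \<Theta>, the homomorphism condition
      constrains only the summand \<open>B\<close>, and there its transpose is the equation of
      \<open>solves_iff\<close>.\<close>
    have hom_iff: "coalgebra_hom D L A d \<Theta> \<zeta> h \<longleftrightarrow> solves (\<phi> X \<Theta> (h \<cdot>\<^bsub>D\<^esub> j))"
      if h: "h \<in> hom D A \<Theta>" and hi: "h \<cdot>\<^bsub>D\<^esub> i = Ident D \<Theta>" for h
    proof -
      note Lh = L.Farr_hom[OF h]
      note Gh = adj.right.Farr_hom[OF h]
      note GLh = adj.right.Farr_hom[OF Lh]
      define g where "g = h \<cdot>\<^bsub>D\<^esub> j"
      have g: "g \<in> hom D B \<Theta>" unfolding g_def by (rule D.Comp_hom[OF j h])
      have f: "\<phi> X \<Theta> g \<in> hom C X Y"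
        using adj.transpose_hom[OF X] g by (simp add: B_def Y_def)
      have Lhi: "Farr L h \<cdot>\<^bsub>D\<^esub> Farr L i = Ident D (Fobj L \<Theta>)"
        by (simp add: L.Farr_Comp[OF i h, symmetric] hi L.Farr_Ident[OF T])
      have GLhi: "Farr G (Farr L h) \<cdot>\<^bsub>C\<^esub> Farr G (Farr L i) = Ident C (Fobj G (Fobj L \<Theta>))"
        by (simp add: adj.right.Farr_Comp[OF Li Lh, symmetric] Lhi adj.right.Farr_Ident[OF LT])
      have tg: "\<phi> X \<Theta> g = Farr G h \<cdot>\<^bsub>C\<^esub> \<phi> X A j"
        unfolding g_def by (rule adj.transpose_Comp[OF X j[unfolded B_def] h])

      have "Farr G (Farr L h) \<cdot>\<^bsub>C\<^esub> (Farr G (Farr L i) \<cdot>\<^bsub>C\<^esub> Farr G \<zeta>) = Farr G \<zeta>"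
        by (simp add: C.Comp_assoc[OF G\<zeta> GLi GLh, symmetric] GLhi C.Ident_left[OF G\<zeta>])
      \<comment> \<open>Naturality of \<rho> at \<open>h\<close> trades \<open>G L h\<close> after
        \<rho> at \<open>A\<close> for \<rho> at \<Theta> after \<open>H G h\<close>; then
        \<open>tg\<close> and functoriality of \<open>H\<close> merge the two arrows under
        \<open>H\<close>.\<close>
      moreover have "Farr G (Farr L h) \<cdot>\<^bsub>C\<^esub> (\<rho> A \<cdot>\<^bsub>C\<^esub> Farr H (\<phi> X A j))
          = \<rho> \<Theta> \<cdot>\<^bsub>C\<^esub> Farr H (\<phi> X \<Theta> g)"
        by (simp add: C.Comp_assoc[OF Htj \<rho>A GLh, symmetric] \<rho>_nat[OF h, symmetric] tg
            H.Farr_Comp[OF tj Gh] C.Comp_assoc[OF Htj H.Farr_hom[OF Gh] \<rho>_hom[OF T]])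
      ultimately have GLhs: "Farr G (Farr L h) \<cdot>\<^bsub>C\<^esub> s
          = copair C SC (Farr G \<zeta>) (\<rho> \<Theta> \<cdot>\<^bsub>C\<^esub> Farr H (\<phi> X \<Theta> g))"
        by (simp add: s_def C.Comp_copair[OF p q GLh])

      have eq_i: "(\<zeta> \<cdot>\<^bsub>D\<^esub> h) \<cdot>\<^bsub>D\<^esub> i = (Farr L h \<cdot>\<^bsub>D\<^esub> d) \<cdot>\<^bsub>D\<^esub> i"
        by (simp add: D.Comp_assoc[OF i h \<zeta>] D.Comp_assoc[OF i d Lh] hi di
            D.Comp_assoc[OF \<zeta> Li Lh, symmetric] Lhi D.Ident_right[OF \<zeta>] D.Ident_left[OF \<zeta>])
      have j_eqs: "(\<zeta> \<cdot>\<^bsub>D\<^esub> h) \<cdot>\<^bsub>D\<^esub> j = \<zeta> \<cdot>\<^bsub>D\<^esub> g" "(Farr L h \<cdot>\<^bsub>D\<^esub> d) \<cdot>\<^bsub>D\<^esub> j = Farr L h \<cdot>\<^bsub>D\<^esub> e"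
        by (simp_all add: D.Comp_assoc[OF j h \<zeta>] D.Comp_assoc[OF j d Lh] g_def dj)
      have "coalgebra_hom D L A d \<Theta> \<zeta> h \<longleftrightarrow> \<zeta> \<cdot>\<^bsub>D\<^esub> h = Farr L h \<cdot>\<^bsub>D\<^esub> d"
        using h by (simp add: coalgebra_hom_def)
      \<comment> \<open>The components along \<open>i\<close> agree by \<open>eq_i\<close>, so only
        those along \<open>j\<close> remain to be compared.\<close>
      also have "\<dots> \<longleftrightarrow> \<zeta> \<cdot>\<^bsub>D\<^esub> g = Farr L h \<cdot>\<^bsub>D\<^esub> e"
        using D.coprod_eqI[OF T B, folded A_def i_def j_def,
            OF D.Comp_hom[OF h \<zeta>] D.Comp_hom[OF d Lh] eq_i] j_eqs by metis
      also have "\<dots> \<longleftrightarrow> \<phi> X (Fobj L \<Theta>) (\<zeta> \<cdot>\<^bsub>D\<^esub> g) = \<phi> X (Fobj L \<Theta>) (Farr L h \<cdot>\<^bsub>D\<^esub> e)"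
        by (rule adj.transpose_eq_iff[OF X, folded B_def,
              OF D.Comp_hom[OF g \<zeta>] D.Comp_hom[OF e Lh], symmetric])
      also have "\<phi> X (Fobj L \<Theta>) (\<zeta> \<cdot>\<^bsub>D\<^esub> g) = Farr G \<zeta> \<cdot>\<^bsub>C\<^esub> \<phi> X \<Theta> g"
        by (rule adj.transpose_Comp[OF X g[unfolded B_def] \<zeta>])
      also have "\<phi> X (Fobj L \<Theta>) (Farr L h \<cdot>\<^bsub>D\<^esub> e) = (Farr G (Farr L h) \<cdot>\<^bsub>C\<^esub> s) \<cdot>\<^bsub>C\<^esub> c"
        by (simp add: adj.transpose_Comp[OF X e[unfolded B_def] Lh] te C.Comp_assoc[OF c s GLh])
      finally show ?thesis
        by (simp add: solves_iff[OF f] GLhs flip: g_def)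
    qed

    \<comment> \<open>Existence and uniqueness of the solution\<close>
    obtain h where h: "coalgebra_hom D L A d \<Theta> \<zeta> h"
      and h_unique: "\<And>k. coalgebra_hom D L A d \<Theta> \<zeta> k \<Longrightarrow> k = h"
      using final[OF A d] by blast
    have hA: "h \<in> hom D A \<Theta>" using h by (simp add: coalgebra_hom_def)
    have "\<exists>!f. f \<in> hom C X Y \<and> solves f"
    proof (rule ex1I)
      show "\<phi> X \<Theta> (h \<cdot>\<^bsub>D\<^esub> j) \<in> hom C X Y \<and> solves (\<phi> X \<Theta> (h \<cdot>\<^bsub>D\<^esub> j))"
        using adj.transpose_hom[OF X, folded B_def, OF D.Comp_hom[OF j hA]]
          hom_iff[OF hA hom_i[OF h]] h by (simp add: Y_def)
    next
      fix f assume f: "f \<in> hom C X Y \<and> solves f"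
      then obtain g where g: "g \<in> hom D B \<Theta>" and tg: "\<phi> X \<Theta> g = f"
        using adj.transpose_surj[OF X T] by (auto simp: B_def Y_def)
      \<comment> \<open>The arrow \<open>g\<close>, whose transpose is the given solution, is
        extended by the identity on \<Theta>; \<open>hom_iff\<close> makes the result a
        homomorphism, and finality identifies it with \<open>h\<close>.\<close>
      define k where "k = copair D SD (Ident D \<Theta>) g"
      have k: "k \<in> hom D A \<Theta>" "k \<cdot>\<^bsub>D\<^esub> i = Ident D \<Theta>" "k \<cdot>\<^bsub>D\<^esub> j = g"
        unfolding k_def A_def i_def j_def by (rule D.copair[OF idT g])+
      have "k = h"
        using h_unique hom_iff[OF k(1,2)] f tg k(3) by simp
      then show "f = \<phi> X \<Theta> (h \<cdot>\<^bsub>D\<^esub> j)"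
        using k(3) tg by simp
    qed
    then show ?thesis by (simp only: solves_def)
  qed
  then have "completely_iterative C SC H Y a"
    using Y a by (simp only: completely_iterative_def is_algebra_def) simp
  then show ?thesis
    by (simp only: a_def z_def Y_def)
qed

end
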